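(* Let $V$ be a finite set; for each $v\in V$ let $\omega_v=f_v(z)dz$ with $f_v$ a cusp form of weight two with respect to a congruence subgroup of $SL_2(\mathbb{Z})$, and let $p_v$ be a prime such that $T_{p_v}\omega_v=\lambda_v\omega_v$ with $\lambda_v\in\mathbb{C}$. With the families $\omega_U$, $\omega_W$ and the continuous ring homomorphisms $l:\mathbb{C}\langle\langle A_U\rangle\rangle\to\mathbb{C}\langle\langle A_V\rangle\rangle$ and $r:\mathbb{C}\langle\langle B_W\rangle\rangle\to\mathbb{C}\langle\langle A_V\rangle\rangle$ defined in the context, we have $$l(J_{i\infty}^0(\omega_U))=r(J_{i\infty}^0(\omega_W)).$$
   Context: For a matrix $\gamma\in GL_2^+(\mathbb{R})$, $\gamma^*$ denotes the pull-back of 1-forms on the upper half plane $H$ under $z\mapsto[\gamma]z$ (the fractional linear transformation). For a prime $p$ the Hecke operator is $$T_p\,\omega=\mathbf{p}^*\omega+\sum_{b=0}^{p-1}h(p,b)^*\omega,\qquad\mathbf{p}=\begin{pmatrix}p&0\\0&1\end{pmatrix},\quad h(p,b)=\begin{pmatrix}1&b\\0&p\end{pmatrix}.$$ For a finite index set $S$ with free noncommuting variables $(X_u)_{u\in S}$ and a family $\omega_S=(\omega_u)_{u\in S}$, $$J_{i\infty}^0(\omega_S)=1+\sum_{n\ge1}\sum_{(u_1,\dots,u_n)\in S^n}X_{u_1}\cdots X_{u_n}\int_{i\infty}^0\omega_{u_1}(z_1)\int_{i\infty}^{z_1}\omega_{u_2}(z_2)\cdots\int_{i\infty}^{z_{n-1}}\omega_{u_n}(z_n),$$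 integration being along the imaginary axis from $i\infty$ to $0$, in the ring $\mathbb{C}\langle\langle X_S\rangle\rangle$ of associative formal power series. $U=V\sqcup V'$, where $V'$ is another copy of $V$; for $v'\in V'$ corresponding to $v\in V$ put $\omega_{v'}=\mathbf{p}_v^*(\omega_v)$, where $\mathbf{p}_v$ is the matrix $\mathbf p$ for $p=p_v$. $\omega_U$ consists of all $\omega_v$ and $\omega_{v'}$, with formal variables $A_v$, $A_{v'}$. $W$ is the set of pairs $(v,b)$ with $v\in V$, $b\in\{0,\dots,p_v-1\}$; $\omega_W$ consists of $\omega_{(v,b)}=h(p_v,b)^*(\omega_v)$, with formal variables $B_{(v,b)}$. $l$ and $r$ are the continuous $\mathbb{C}$-algebra homomorphisms with $l(A_v)=\lambda_vA_v$, $l(A_{v'})=-A_v$, and $r(B_{(v,b)})=A_v$. *)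

theory Defs
  imports
    "HOL-Analysis.Analysis"
    "HOL-Algebra.Ring"
    "HOL-Number_Theory.Cong"
begin

section \<open>Cusp forms for congruence subgroups\<close>

definition upper_half :: "complex set"
  where "upper_half = {z. Im z > 0}"

definition SL2Z :: "(int^2^2) monoid"
  where "SL2Z = \<lparr>carrier = {\<gamma>. det \<gamma> = 1}, mult = (\<lambda>\<alpha> \<beta>. \<alpha> ** \<beta>), one = mat 1\<rparr>"

definition principal_congruence_subgroup :: "nat \<Rightarrow> (int^2^2) set"
  where "principal_congruence_subgroup N =
    {\<gamma> \<in> carrier SL2Z. \<forall>i j. [\<gamma> $ i $ j = mat 1 $ i $ j] (mod (int N))}"

definition congruence_subgroup :: "(int^2^2) set \<Rightarrow> bool"
  where "congruence_subgroup \<Gamma> \<longleftrightarrow>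
    subgroup \<Gamma> SL2Z \<and> (\<exists>N>0. principal_congruence_subgroup N \<subseteq> \<Gamma>)"

definition slash :: "int \<Rightarrow> int^2^2 \<Rightarrow> (complex \<Rightarrow> complex) \<Rightarrow> complex \<Rightarrow> complex"
  where "slash k \<gamma> f z =
    (of_int (\<gamma>$2$1) * z + of_int (\<gamma>$2$2)) powi (-k) *
    f (moebius (of_int (\<gamma>$1$1)) (of_int (\<gamma>$1$2)) (of_int (\<gamma>$2$1)) (of_int (\<gamma>$2$2)) z)"

text \<open>A function on the upper half plane is represented by a function on the complex plane
  whose values outside the upper half plane are irrelevant. The last clause says that at every
  cusp the Fourier expansion in $e^{2\pi i z/h}$ has only terms of positive exponent.\<close>

definition cusp_form :: "int \<Rightarrow> (int^2^2) set \<Rightarrow> (complex \<Rightarrow> complex) \<Rightarrow> bool"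
  where "cusp_form k \<Gamma> f \<longleftrightarrow>
    f holomorphic_on upper_half \<and>
    (\<forall>\<gamma>\<in>\<Gamma>. \<forall>z\<in>upper_half. slash k \<gamma> f z = f z) \<and>
    (\<forall>\<alpha>\<in>carrier SL2Z. \<exists>h::nat. h > 0 \<and> (\<exists>a :: nat \<Rightarrow> complex. a 0 = 0 \<and>
      (\<forall>z\<in>upper_half.
        (\<lambda>n. a n * exp (2 * of_real pi * \<i> * of_nat n * z / of_nat h)) sums slash k \<alpha> f z)))"


section \<open>One-forms and Hecke operators\<close>

text \<open>A holomorphic 1-form $f(z)\,dz$ on the upper half plane is represented by its coefficient
  function $f$, so that the pull-back along $\varphi$ has the coefficient
  $f(\varphi(z))\,\varphi'(z)$.\<close>

definition pullback :: "real^2^2 \<Rightarrow> (complex \<Rightarrow> complex) \<Rightarrow> complex \<Rightarrow> complex"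
  where "pullback \<gamma> f z =
    (let \<phi> = moebius (of_real (\<gamma>$1$1)) (of_real (\<gamma>$1$2)) (of_real (\<gamma>$2$1)) (of_real (\<gamma>$2$2))
     in f (\<phi> z) * deriv \<phi> z)"

definition p_mat :: "nat \<Rightarrow> real^2^2"
  where "p_mat p = vector [vector [of_nat p, 0], vector [0, 1]]"

definition h_mat :: "nat \<Rightarrow> nat \<Rightarrow> real^2^2"
  where "h_mat p b = vector [vector [1, of_nat b], vector [0, of_nat p]]"

definition hecke :: "nat \<Rightarrow> (complex \<Rightarrow> complex) \<Rightarrow> complex \<Rightarrow> complex"
  where "hecke p f z = pullback (p_mat p) f z + (\<Sum>b<p. pullback (h_mat p b) f z)"


section \<open>Noncommutative formal power series\<close>

text \<open>Series in free variables indexed by \<open>S\<close> are functions from words to coefficients that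
  vanish on words with a letter outside \<open>S\<close>. The product is the Cauchy product over all
  factorisations of a word.\<close>

type_synonym 's ncps = "'s list \<Rightarrow> complex"

definition ncps :: "'s set \<Rightarrow> 's ncps ring"
  where "ncps S =
    \<lparr>carrier = {F. \<forall>w. w \<notin> lists S \<longrightarrow> F w = 0},
     mult = (\<lambda>F G w. \<Sum>i\<le>length w. F (take i w) * G (drop i w)),
     one = (\<lambda>w. if w = [] then 1 else 0),
     zero = (\<lambda>w. 0),
     add = (\<lambda>F G w. F w + G w)\<rparr>"

lemma cauchy_assoc:
  fixes F G H :: "'s ncps"
  shows "(\<Sum>i\<le>length w. (\<Sum>j\<le>length (take i w). F (take j (take i w)) * G (drop j (take i w))) * H (drop i w))
   = (\<Sum>j\<le>length w. F (take j w) * (\<Sum>i\<le>length (drop j w). G (take i (drop j w)) * H (drop i (drop j w))))"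
proof -
  have "(\<Sum>i\<le>length w. (\<Sum>j\<le>length (take i w). F (take j (take i w)) * G (drop j (take i w))) * H (drop i w))
    = (\<Sum>i\<le>length w. \<Sum>j\<le>i. F (take j w) * G (take (i-j) (drop j w)) * H (drop i w))"
    by (auto intro!: sum.cong simp: sum_distrib_right drop_take min_def)
  also have "\<dots> = (\<Sum>(i,j)\<in>(SIGMA i:{..length w}. {..i}). F (take j w) * G (take (i-j) (drop j w)) * H (drop i w))"
    by (simp add: sum.Sigma)
  also have "\<dots> = (\<Sum>(j,i)\<in>(SIGMA j:{..length w}. {..length w - j}). F (take j w) * G (take i (drop j w)) * H (drop i (drop j w)))"
    by (rule sum.reindex_bij_witness[where i="\<lambda>(j,i). (i+j,j)" and j="\<lambda>(i,j). (j,i-j)"]) auto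
  also have "\<dots> = (\<Sum>j\<le>length w. F (take j w) * (\<Sum>i\<le>length (drop j w). G (take i (drop j w)) * H (drop i (drop j w))))"
    by (auto intro!: sum.cong simp: sum.Sigma[symmetric] sum_distrib_left mult.assoc)
  finally show ?thesis .
qed

lemma append_lists_split: "w \<notin> lists S \<Longrightarrow> take i w \<notin> lists S \<or> drop i w \<notin> lists S"
  by (metis append_take_drop_id append_in_lists_conv)

lemma ring_ncps: "ring (ncps S)"
proof (rule ringI)
  show "abelian_group (ncps S)"
  proof (rule abelian_groupI)
    fix F assume "F \<in> carrier (ncps S)"
    then show "\<exists>G\<in>carrier (ncps S). G \<oplus>\<^bsub>ncps S\<^esub> F = \<zero>\<^bsub>ncps S\<^esub>"
      by (intro bexI[of _ "\<lambda>w. - F w"]) (auto simp: ncps_def)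
  qed (auto simp: ncps_def)
  show "monoid (ncps S)"
  proof (rule monoidI)
    fix F G assume "F \<in> carrier (ncps S)" "G \<in> carrier (ncps S)"
    then show "F \<otimes>\<^bsub>ncps S\<^esub> G \<in> carrier (ncps S)"
      by (auto simp: ncps_def intro!: sum.neutral dest: append_lists_split)
        (metis append_lists_split  in_lists_conv_set)
  next
    show "\<one>\<^bsub>ncps S\<^esub> \<in> carrier (ncps S)" by (auto simp: ncps_def)
  next
    fix F G H assume "F \<in> carrier (ncps S)" "G \<in> carrier (ncps S)" "H \<in> carrier (ncps S)"
    show "F \<otimes>\<^bsub>ncps S\<^esub> G \<otimes>\<^bsub>ncps S\<^esub> H = F \<otimes>\<^bsub>ncps S\<^esub> (G \<otimes>\<^bsub>ncps S\<^esub> H)"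
      unfolding ncps_def by (simp only: ring_record_simps monoid.simps partial_object.simps cauchy_assoc)
  next
    fix F assume "F \<in> carrier (ncps S)"
    have "(\<Sum>i\<le>length w. (if take i w = [] then 1 else 0) * F (drop i w)) = F w" for w
    proof -
      have "(\<Sum>i\<le>length w. (if take i w = [] then 1 else 0) * F (drop i w))
         = (\<Sum>i\<le>length w. if i = 0 then F w else 0)"
        by (rule sum.cong) auto
      then show ?thesis by simp
    qed
    then show "\<one>\<^bsub>ncps S\<^esub> \<otimes>\<^bsub>ncps S\<^esub> F = F" by (simp add: ncps_def fun_eq_iff)
    have "(\<Sum>i\<le>length w. F (take i w) * (if drop i w = [] then 1 else 0)) = F w" for w
    proof -
      have "(\<Sum>i\<le>length w. F (take i w) * (if drop i w = [] then 1 else 0))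
         = (\<Sum>i\<le>length w. if i = length w then F w else 0)"
        by (rule sum.cong) auto
      then show ?thesis by simp
    qed
    then show "F \<otimes>\<^bsub>ncps S\<^esub> \<one>\<^bsub>ncps S\<^esub> = F" by (simp add: ncps_def fun_eq_iff)
  qed
qed (auto simp: ncps_def fun_eq_iff algebra_simps sum.distrib)

definition ncps_scale :: "complex \<Rightarrow> 's ncps \<Rightarrow> 's ncps"
  where "ncps_scale c F = (\<lambda>w. c * F w)"

definition ncps_var :: "'s \<Rightarrow> 's ncps"
  where "ncps_var u = (\<lambda>w. if w = [u] then 1 else 0)"

text \<open>The topology of coefficientwise convergence with discrete coefficients; for finite \<open>S\<close>
  this is the adic topology of the ideal generated by the variables.\<close>

definition ncps_topology :: "'s set \<Rightarrow> 's ncps topology"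
  where "ncps_topology S =
    subtopology (product_topology (\<lambda>_. discrete_topology UNIV) UNIV) (carrier (ncps S))"

definition continuous_alg_hom :: "'s set \<Rightarrow> 't set \<Rightarrow> ('s ncps \<Rightarrow> 't ncps) \<Rightarrow> bool"
  where "continuous_alg_hom S T \<Phi> \<longleftrightarrow>
    \<Phi> \<in> ring_hom (ncps S) (ncps T) \<and>
    (\<forall>c. \<forall>F\<in>carrier (ncps S). \<Phi> (ncps_scale c F) = ncps_scale c (\<Phi> F)) \<and>
    continuous_map (ncps_topology S) (ncps_topology T) \<Phi>"

text \<open>The homomorphism with $X_u \mapsto c_u Y_{\varphi(u)}$. It shows that continuous homomorphisms with the
  values on the variables used below exist.\<close>

definition ncps_subst :: "'s set \<Rightarrow> ('s \<Rightarrow> 't) \<Rightarrow> ('s \<Rightarrow> complex) \<Rightarrow> 's ncps \<Rightarrow> 't ncps"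
  where "ncps_subst S \<phi> c F = (\<lambda>w. \<Sum>u | u \<in> lists S \<and> map \<phi> u = w. (\<Prod>x\<leftarrow>u. c x) * F u)"

lemma finite_fibre: "finite S \<Longrightarrow> finite {u. u \<in> lists S \<and> map \<phi> u = w}"
  by (rule finite_subset[OF _ finite_lists_length_eq[of S "length w"]]) auto

lemma ncps_subst_mult:
  fixes F G :: "'s ncps"
  assumes "finite S"
  shows "ncps_subst S \<phi> c (\<lambda>w. \<Sum>i\<le>length w. F (take i w) * G (drop i w)) w
    = (\<Sum>i\<le>length w. ncps_subst S \<phi> c F (take i w) * ncps_subst S \<phi> c G (drop i w))"
proof -
  let ?A = "\<lambda>w. {u. u \<in> lists S \<and> map \<phi> u = w}"
  let ?c = "\<lambda>u. \<Prod>x\<leftarrow>u. c x"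
  have "ncps_subst S \<phi> c (\<lambda>w. \<Sum>i\<le>length w. F (take i w) * G (drop i w)) w
    = (\<Sum>u\<in>?A w. \<Sum>i\<le>length w. ?c u * (F (take i u) * G (drop i u)))"
    unfolding ncps_subst_def sum_distrib_left by (rule sum.cong) auto
  also have "\<dots> = (\<Sum>i\<le>length w. \<Sum>u\<in>?A w. ?c u * (F (take i u) * G (drop i u)))"
    by (rule sum.swap)
  also have "\<dots> = (\<Sum>i\<le>length w. \<Sum>(u,v)\<in>?A (take i w) \<times> ?A (drop i w). (?c u * F u) * (?c v * G v))"
  proof (rule sum.cong[OF refl])
    fix i assume i: "i \<in> {..length w}"
    show "(\<Sum>u\<in>?A w. ?c u * (F (take i u) * G (drop i u))) =
      (\<Sum>(u,v)\<in>?A (take i w) \<times> ?A (drop i w). (?c u * F u) * (?c v * G v))"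
    proof (rule sum.reindex_bij_witness[where i="\<lambda>(u,v). u @ v" and j="\<lambda>u. (take i u, drop i u)"])
      fix u assume u: "u \<in> ?A w"
      show "(\<lambda>(u,v). u @ v) (take i u, drop i u) = u" by simp
      show "(take i u, drop i u) \<in> ?A (take i w) \<times> ?A (drop i w)"
        using u by (auto simp: take_map drop_map dest: in_set_takeD in_set_dropD)
      have "?c u = ?c (take i u) * ?c (drop i u)"
        by (metis append_take_drop_id map_append prod_list.append)
      then show "(case (take i u, drop i u) of (u,v) \<Rightarrow> (?c u * F u) * (?c v * G v))
          = ?c u * (F (take i u) * G (drop i u))" by simp
    next
      fix q assume q: "q \<in> ?A (take i w) \<times> ?A (drop i w)"
      obtain u v where [simp]: "q = (u,v)" by (cases q)
      have "length (map \<phi> u) = i" using q i by auto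
      then have "length u = i" by simp
      then show "(\<lambda>u. (take i u, drop i u)) ((\<lambda>(u,v). u @ v) q) = q" by simp
      show "(case q of (u,v) \<Rightarrow> u @ v) \<in> ?A w" using q by auto
    qed
  qed
  also have "\<dots> = (\<Sum>i\<le>length w. ncps_subst S \<phi> c F (take i w) * ncps_subst S \<phi> c G (drop i w))"
    by (simp add: ncps_subst_def sum_product sum.cartesian_product)
  finally show ?thesis .
qed

lemma continuous_alg_hom_ncps_subst:
  assumes "finite S" "\<phi> \<in> S \<rightarrow> T"
  shows "continuous_alg_hom S T (ncps_subst S \<phi> c)"
proof -
  let ?A = "\<lambda>w. {u. u \<in> lists S \<and> map \<phi> u = w}"
  have carr: "ncps_subst S \<phi> c F \<in> carrier (ncps T)" for F
    using assms(2) by (fastforce simp: ncps_def ncps_subst_def intro!: sum.neutral)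
  have empty: "{u. u = [] \<and> u \<in> lists S} = {[]}" "{u. u \<in> lists S \<and> u = []} = {[]}" by auto
  have "ncps_subst S \<phi> c \<one>\<^bsub>ncps S\<^esub> = \<one>\<^bsub>ncps T\<^esub>"
  proof
    fix w
    show "ncps_subst S \<phi> c \<one>\<^bsub>ncps S\<^esub> w = \<one>\<^bsub>ncps T\<^esub> w"
      by (cases w) (auto simp: ncps_def ncps_subst_def empty intro!: sum.neutral)
  qed
  then have hom: "ncps_subst S \<phi> c \<in> ring_hom (ncps S) (ncps T)"
    using carr ncps_subst_mult[OF assms(1), of \<phi> c]
    by (intro ring_hom_memI) (auto simp: ncps_def ncps_subst_def fun_eq_iff algebra_simps sum.distrib)
  have "continuous_map (ncps_topology S) (discrete_topology UNIV) (\<lambda>F. ncps_subst S \<phi> c F w)" for w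
  proof -
    define X where "X = subtopology (product_topology (\<lambda>_::'a list. discrete_topology (UNIV :: complex set)) UNIV) (carrier (ncps S))"
    have proj: "continuous_map X (discrete_topology UNIV) (\<lambda>F. F u)" for u
      unfolding X_def by (intro continuous_map_from_subtopology continuous_map_product_projection) auto
    have "continuous_map X (discrete_topology UNIV) (\<lambda>F. \<Sum>u\<in>B. (\<Prod>x\<leftarrow>u. c x) * F u)" if "finite B" for B
      using that
    proof induction
      case (insert u B)
      have "continuous_map X (prod_topology (discrete_topology UNIV) (discrete_topology UNIV))
          (\<lambda>F. (F u, \<Sum>u\<in>B. (\<Prod>x\<leftarrow>u. c x) * F u))"
        using proj insert by (simp add: continuous_map_paired)
      moreover have "continuous_map (prod_topology (discrete_topology UNIV) (discrete_topology UNIV)) (discrete_topology UNIV)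
          (\<lambda>(a,b). (\<Prod>x\<leftarrow>u. c x) * a + b)"
        by (simp flip: prod_topology_discrete_topology)
      ultimately have "continuous_map X (discrete_topology UNIV)
         ((\<lambda>(a,b). (\<Prod>x\<leftarrow>u. c x) * a + b) \<circ> (\<lambda>F. (F u, \<Sum>u\<in>B. (\<Prod>x\<leftarrow>u. c x) * F u)))"
        by (rule continuous_map_compose)
      then show ?case using insert by (simp add: o_def)
    qed simp
    from this[OF finite_fibre[OF assms(1)]] show ?thesis
      by (simp add: ncps_topology_def ncps_subst_def X_def)
  qed
  then have "continuous_map (ncps_topology S) (ncps_topology T) (ncps_subst S \<phi> c)"
    using carr unfolding ncps_topology_def[of T]
    by (auto simp: continuous_map_in_subtopology continuous_map_componentwise_UNIV)
  with hom show ?thesis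
    by (simp add: continuous_alg_hom_def ncps_scale_def ncps_subst_def sum_distrib_left mult.left_commute)
qed

lemma ncps_subst_var:
  assumes "finite S" "u \<in> S"
  shows "ncps_subst S \<phi> c (ncps_var u) = ncps_scale (c u) (ncps_var (\<phi> u))"
proof
  fix w
  show "ncps_subst S \<phi> c (ncps_var u) w = ncps_scale (c u) (ncps_var (\<phi> u)) w"
  proof (cases "w = [\<phi> u]")
    case True
    have "{x \<in> lists S. map \<phi> x = [\<phi> u]} = (\<lambda>y. [y]) ` {y \<in> S. \<phi> y = \<phi> u}" by auto
    then have f: "ncps_subst S \<phi> c (ncps_var u) w = (\<Sum>y | y \<in> S \<and> \<phi> y = \<phi> u. if y = u then c u else 0)"
      using True by (auto simp: ncps_subst_def ncps_var_def sum.reindex inj_on_def intro!: sum.cong)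
    show ?thesis
    proof (cases "finite {y. y \<in> S \<and> \<phi> y = \<phi> u}")
      case True
      then show ?thesis using f assms \<open>w = _\<close> by (simp add: ncps_scale_def ncps_var_def)
    qed (use \<open>finite S\<close> in simp)
  next
    case False
    then show ?thesis by (auto simp: ncps_subst_def ncps_scale_def ncps_var_def intro!: sum.neutral)
  qed
qed



section \<open>Iterated integrals along the imaginary axis\<close>

text \<open>\<open>iter_int [f\<^sub>1, \<dots>, f\<^sub>n] y\<close> is
  $\int_{i\infty}^{iy} f_1(z_1)\,dz_1\int_{i\infty}^{z_1} f_2(z_2)\,dz_2\cdots
    \int_{i\infty}^{z_{n-1}} f_n(z_n)\,dz_n$ with the parametrisation $z = it$, $dz = i\,dt$.
  The interval integral is oriented: it runs downwards from $\infty$ to $y$.\<close>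

fun iter_int :: "(complex \<Rightarrow> complex) list \<Rightarrow> real \<Rightarrow> complex"
  where
    "iter_int [] y = 1"
  | "iter_int (f # fs) y =
      (LBINT t=\<infinity>..ereal y. f (\<i> * of_real t) * iter_int fs t * \<i>)"

definition J_series :: "'s set \<Rightarrow> ('s \<Rightarrow> complex \<Rightarrow> complex) \<Rightarrow> 's ncps"
  where "J_series S \<omega> = (\<lambda>w. if w \<in> lists S then iter_int (map \<omega> w) 0 else 0)"


section \<open>The two derived families\<close>

text \<open>The index set \<open>U\<close> is the disjoint sum \<open>V <+> V\<close>; the copy \<open>V'\<close> is the right summand.\<close>

definition omega_U :: "('v \<Rightarrow> nat) \<Rightarrow> ('v \<Rightarrow> complex \<Rightarrow> complex) \<Rightarrow> 'v + 'v \<Rightarrow> complex \<Rightarrow> complex"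
  where "omega_U p \<omega> = case_sum \<omega> (\<lambda>v. pullback (p_mat (p v)) (\<omega> v))"

definition index_W :: "'v set \<Rightarrow> ('v \<Rightarrow> nat) \<Rightarrow> ('v \<times> nat) set"
  where "index_W V p = (SIGMA v:V. {..<p v})"

definition omega_W :: "('v \<Rightarrow> nat) \<Rightarrow> ('v \<Rightarrow> complex \<Rightarrow> complex) \<Rightarrow> 'v \<times> nat \<Rightarrow> complex \<Rightarrow> complex"
  where "omega_W p \<omega> = (\<lambda>(v, b). pullback (h_mat (p v) b) (\<omega> v))"

end

theory Submission
  imports Defs "HOL-Probability.Sinc_Integral"
begin

text \<open>
  Rewritten as an identity of coefficient functions, the Hecke equation says
  $\lambda_v\omega_v - \mathbf{p}_v^*\omega_v = \sum_b h(p_v,b)^*\omega_v$. An iterated integral is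
  multilinear in its forms, and the homomorphisms \<open>l\<close> and \<open>r\<close> are the formal counterpart of this
  multilinearity: the coefficient of $A_{v_1}\cdots A_{v_n}$ in the image of a generating series
  is the sum of the iterated integrals over all words above $(v_1,\dots,v_n)$, weighted by the products
  of the scalars, hence it is the iterated integral of the combined forms. For \<open>l\<close> these
  are the left-hand sides of the equations above, for \<open>r\<close> the right-hand sides, so the two images
  agree.

  Two points need an argument. First, \<open>l\<close> and \<open>r\<close> are given by their values on the variables only, so
  their coefficients are known only after showing that a continuous homomorphism is determined by
  these values (\<open>continuous_alg_hom_unique\<close>); this is the density of polynomials. Second,
  linearity of the Lebesgue integral requires each summand to be integrable separately, also after
  the Hecke sum has been split up. It suffices that every form is absolutely integrable along
  the imaginary axis, since then the inner iterated integrals are bounded and measurable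
  (\<open>iter_int_bounded_measurable\<close>, \<open>iter_int_multilinear\<close>). The pull-back under $h(p,b)$ moves the axis to
  the vertical line over the rational number $b/p$, so the required estimate is that a cusp
  form of weight two is integrable on every vertical line that ends at a rational number
  (\<open>cusp_form_integrable_over_rational\<close>): it decays exponentially towards $i\infty$, and it stays
  bounded towards the cusp $b/p$ because the exponential decay of its expansion there dominates the
  automorphy factor.
\<close>

section \<open>Continuous homomorphisms are determined by the variables\<close>

lemma continuous_alg_hom_closed:
  assumes "continuous_alg_hom S T \<Phi>" "F \<in> carrier (ncps S)"
  shows "\<Phi> F \<in> carrier (ncps T)"
  using assms by (auto simp: continuous_alg_hom_def dest: ring_hom_closed)

lemma continuous_alg_hom_add:
  assumes "continuous_alg_hom S T \<Phi>" "F \<in> carrier (ncps S)" "G \<in> carrier (ncps S)"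
  shows "\<Phi> (\<lambda>w. F w + G w) = (\<lambda>w. \<Phi> F w + \<Phi> G w)"
proof -
  have "\<Phi> (F \<oplus>\<^bsub>ncps S\<^esub> G) = \<Phi> F \<oplus>\<^bsub>ncps T\<^esub> \<Phi> G"
    using assms by (auto simp: continuous_alg_hom_def dest: ring_hom_add)
  then show ?thesis by (simp add: ncps_def)
qed

lemma continuous_alg_hom_zero:
  assumes "continuous_alg_hom S T \<Phi>"
  shows "\<Phi> (\<lambda>w. 0) = (\<lambda>w. 0)"
proof -
  have "(\<lambda>w. 0) \<in> carrier (ncps S)" by (simp add: ncps_def)
  with assms have "\<Phi> (ncps_scale 0 (\<lambda>w. 0)) = ncps_scale 0 (\<Phi> (\<lambda>w. 0))"
    unfolding continuous_alg_hom_def by blast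
  then show ?thesis by (simp add: ncps_scale_def)
qed

definition ncps_monom :: "'s list \<Rightarrow> 's ncps"
  where "ncps_monom w = (\<lambda>u. if u = w then 1 else 0)"

lemma ncps_monom_closed: "w \<in> lists S \<Longrightarrow> ncps_monom w \<in> carrier (ncps S)"
  by (auto simp: ncps_monom_def ncps_def)

lemma ncps_monom_Nil: "ncps_monom [] = \<one>\<^bsub>ncps S\<^esub>"
  by (simp add: ncps_monom_def ncps_def)

lemma ncps_monom_Cons: "ncps_monom (x # w) = ncps_var x \<otimes>\<^bsub>ncps S\<^esub> ncps_monom w"
proof
  fix u
  have "(\<Sum>i\<le>length u. ncps_var x (take i u) * ncps_monom w (drop i u))
      = (\<Sum>i\<le>length u. if i = 1 then (if u = x # w then 1 else 0) else 0)"
  proof (rule sum.cong[OF refl])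
    fix i assume "i \<in> {..length u}"
    then show "ncps_var x (take i u) * ncps_monom w (drop i u)
        = (if i = 1 then (if u = x # w then 1 else 0) else 0)"
      by (cases u; cases i) (auto simp: ncps_var_def ncps_monom_def)
  qed
  also have "\<dots> = ncps_monom (x # w) u"
    by (auto simp: ncps_monom_def)
  finally show "ncps_monom (x # w) u = (ncps_var x \<otimes>\<^bsub>ncps S\<^esub> ncps_monom w) u"
    by (simp add: ncps_def)
qed

lemma continuous_alg_hom_eq_on_monom:
  assumes \<Phi>: "continuous_alg_hom S T \<Phi>" and \<Psi>: "continuous_alg_hom S T \<Psi>"
    and var: "\<And>u. u \<in> S \<Longrightarrow> \<Phi> (ncps_var u) = \<Psi> (ncps_var u)"
    and "w \<in> lists S"
  shows "\<Phi> (ncps_monom w) = \<Psi> (ncps_monom w)"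
  using \<open>w \<in> lists S\<close>
proof induction
  case Nil
  then show ?case
    using \<Phi> \<Psi> by (simp add: ncps_monom_Nil[of S] continuous_alg_hom_def
        ring_hom_one[where R = "ncps S" and S = "ncps T"])
next
  case (Cons x w)
  have c: "ncps_var x \<in> carrier (ncps S)" "ncps_monom w \<in> carrier (ncps S)"
    using Cons by (auto simp: ncps_var_def ncps_def ncps_monom_def)
  have h: "\<Phi> \<in> ring_hom (ncps S) (ncps T)" "\<Psi> \<in> ring_hom (ncps S) (ncps T)"
    using \<Phi> \<Psi> by (auto simp: continuous_alg_hom_def)
  have "\<Phi> (ncps_monom (x # w)) = \<Phi> (ncps_var x) \<otimes>\<^bsub>ncps T\<^esub> \<Phi> (ncps_monom w)"
    unfolding ncps_monom_Cons[of x w S] by (rule ring_hom_mult[OF h(1) c])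
  also have "\<dots> = \<Psi> (ncps_var x) \<otimes>\<^bsub>ncps T\<^esub> \<Psi> (ncps_monom w)"
    by (simp add: var[OF Cons.hyps(1)] Cons.IH)
  also have "\<dots> = \<Psi> (ncps_monom (x # w))"
    unfolding ncps_monom_Cons[of x w S] by (rule ring_hom_mult[OF h(2) c, symmetric])
  finally show ?case .
qed

lemma continuous_alg_hom_eq_on_polynomial:
  assumes \<Phi>: "continuous_alg_hom S T \<Phi>" and \<Psi>: "continuous_alg_hom S T \<Psi>"
    and var: "\<And>u. u \<in> S \<Longrightarrow> \<Phi> (ncps_var u) = \<Psi> (ncps_var u)"
    and "finite B" "B \<subseteq> lists S"
  shows "\<Phi> (\<lambda>w. if w \<in> B then F w else 0) = \<Psi> (\<lambda>w. if w \<in> B then F w else 0)"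
  using \<open>finite B\<close> \<open>B \<subseteq> lists S\<close>
proof induction
  case empty
  show ?case by (simp add: continuous_alg_hom_zero[OF \<Phi>] continuous_alg_hom_zero[OF \<Psi>])
next
  case (insert u B)
  let ?G = "\<lambda>w. if w \<in> B then F w else 0" and ?M = "ncps_scale (F u) (ncps_monom u)"
  have split: "(\<lambda>w. if w \<in> insert u B then F w else 0) = (\<lambda>w. ?M w + ?G w)"
    using insert by (auto simp: ncps_scale_def ncps_monom_def fun_eq_iff)
  have u: "ncps_monom u \<in> carrier (ncps S)" using insert by (simp add: ncps_monom_closed)
  then have c: "?M \<in> carrier (ncps S)" "?G \<in> carrier (ncps S)"
    using insert by (auto simp: ncps_def ncps_scale_def)
  have "\<Phi> ?M = \<Psi> ?M"
    using \<Phi> \<Psi> u continuous_alg_hom_eq_on_monom[OF \<Phi> \<Psi> var, of u] insert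
    by (simp add: continuous_alg_hom_def)
  with insert show ?case
    unfolding split continuous_alg_hom_add[OF \<Phi> c] continuous_alg_hom_add[OF \<Psi> c] by simp
qed

text \<open>The coefficients are discrete, so convergence means that every single coefficient is eventually
  constant.\<close>

lemma limitin_ncps_truncation:
  assumes "F \<in> carrier (ncps S)"
  shows "limitin (ncps_topology S) (\<lambda>n w. if length w \<le> n then F w else 0) F sequentially"
proof -
  have "limitin (discrete_topology UNIV) (\<lambda>n. if length w \<le> n then F w else 0) (F w) sequentially" for w
    by (intro limitin_eventually) (auto simp: eventually_sequentially intro!: exI[of _ "length w"])
  then show ?thesis
    using assms unfolding ncps_topology_def limitin_subtopology limitin_componentwise
    by (auto simp: ncps_def)
qed

lemma continuous_alg_hom_eventually_truncation:
  assumes \<Phi>: "continuous_alg_hom S T \<Phi>" and F: "F \<in> carrier (ncps S)"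
  shows "\<forall>\<^sub>F n in sequentially. \<Phi> (\<lambda>w. if length w \<le> n then F w else 0) u = \<Phi> F u"
proof -
  have "limitin (ncps_topology T) (\<Phi> \<circ> (\<lambda>n w. if length w \<le> n then F w else 0)) (\<Phi> F) sequentially"
    using \<Phi> limitin_ncps_truncation[OF F]
    by (intro continuous_map_limit) (auto simp: continuous_alg_hom_def)
  then have "limitin (discrete_topology UNIV) (\<lambda>n. \<Phi> (\<lambda>w. if length w \<le> n then F w else 0) u) (\<Phi> F u) sequentially"
    unfolding ncps_topology_def limitin_subtopology limitin_componentwise by auto
  then have "\<forall>\<^sub>F n in sequentially. \<Phi> (\<lambda>w. if length w \<le> n then F w else 0) u \<in> {\<Phi> F u}"
    unfolding limitin_def by (elim conjE allE[of _ "{\<Phi> F u}"]) auto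
  then show ?thesis by simp
qed

text \<open>For finite \<open>S\<close> a truncation has finitely many terms, so it is a polynomial, and on polynomials the
  two homomorphisms agree by multiplicativity and linearity. A fixed coefficient of the image of a
  series already occurs in the images of all long enough truncations.\<close>

lemma continuous_alg_hom_unique:
  assumes "finite S"
    and \<Phi>: "continuous_alg_hom S T \<Phi>" and \<Psi>: "continuous_alg_hom S T \<Psi>"
    and var: "\<And>u. u \<in> S \<Longrightarrow> \<Phi> (ncps_var u) = \<Psi> (ncps_var u)"
    and F: "F \<in> carrier (ncps S)"
  shows "\<Phi> F = \<Psi> F"
proof
  fix u
  have "\<Phi> (\<lambda>w. if length w \<le> n then F w else 0) = \<Psi> (\<lambda>w. if length w \<le> n then F w else 0)" for n
  proof -
    let ?B = "{w. set w \<subseteq> S \<and> length w \<le> n}"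
    have "(\<lambda>w. if length w \<le> n then F w else 0) = (\<lambda>w. if w \<in> ?B then F w else 0)"
      using F by (auto simp: ncps_def fun_eq_iff)
    then show ?thesis
      using continuous_alg_hom_eq_on_polynomial[OF \<Phi> \<Psi> var, of ?B F]
        finite_lists_length_le[OF \<open>finite S\<close>] by (auto simp: subset_eq)
  qed
  note agree = this
  have "\<forall>\<^sub>F n::nat in sequentially. \<Phi> F u = \<Psi> F u"
    using continuous_alg_hom_eventually_truncation[OF \<Phi> F, of u]
      continuous_alg_hom_eventually_truncation[OF \<Psi> F, of u]
    by eventually_elim (metis agree)
  then show "\<Phi> F u = \<Psi> F u" by simp
qed

section \<open>Multilinearity of iterated integrals\<close>

definition axis_integrable :: "(complex \<Rightarrow> complex) \<Rightarrow> bool"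
  where "axis_integrable g \<longleftrightarrow> set_integrable lborel {0<..} (\<lambda>t. g (\<i> * of_real t))"

text \<open>The sign is the orientation: the integration runs from $\infty$ down to $y$.\<close>

lemma iter_int_Cons:
  "iter_int (g # gs) y = - (LINT t:{y<..}|lborel. g (\<i> * of_real t) * iter_int gs t * \<i>)"
  by (simp add: interval_lebesgue_integral_def)

lemma iter_int_cong:
  assumes "list_all2 (\<lambda>g h. \<forall>t>0. g (\<i> * of_real t) = h (\<i> * of_real t)) gs hs" "0 \<le> y"
  shows "iter_int gs y = iter_int hs y"
  using assms
proof (induction arbitrary: y rule: list_all2_induct)
  case (Cons g gs h hs)
  then show ?case
    unfolding iter_int_Cons by (auto intro!: set_lebesgue_integral_cong)
qed simp

lemma axis_integrable_mult_bounded: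
  assumes "axis_integrable g"
    and "set_borel_measurable borel {0<..} h" "\<And>t. 0 < t \<Longrightarrow> norm (h t) \<le> M"
  shows "set_integrable lborel {0<..} (\<lambda>t. g (\<i> * of_real t) * h t * \<i>)"
proof (rule set_integrable_bound)
  show "set_integrable lborel {0<..} (\<lambda>t. of_real M * g (\<i> * of_real t))"
    using assms(1) by (simp add: axis_integrable_def)
  have m: "(\<lambda>t. (indicator {0<..} t *\<^sub>R g (\<i> * of_real t)) * (indicator {0<..} t *\<^sub>R h t) * \<i>) \<in> borel_measurable borel"
    using assms(1,2) unfolding axis_integrable_def set_integrable_def set_borel_measurable_def
    by (intro borel_measurable_times borel_measurable_const) (auto dest: borel_measurable_integrable)
  show "set_borel_measurable lborel {0<..} (\<lambda>t. g (\<i> * of_real t) * h t * \<i>)"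
  proof -
    have "(\<lambda>t. indicator {0<..} t *\<^sub>R (g (\<i> * of_real t) * h t * \<i>))
        = (\<lambda>t. (indicator {0<..} t *\<^sub>R g (\<i> * of_real t)) * (indicator {0<..} t *\<^sub>R h t) * \<i>)"
      by (auto simp: indicator_def)
    with m show ?thesis by (simp add: set_borel_measurable_def)
  qed
  show "AE t in lborel. t \<in> {0<..} \<longrightarrow>
      norm (g (\<i> * of_real t) * h t * \<i>) \<le> norm (of_real M * g (\<i> * of_real t))"
  proof (intro AE_I2 impI)
    fix t :: real assume "t \<in> {0<..}"
    then have "norm (h t) \<le> \<bar>M\<bar>" using assms(3)[of t] by auto
    then show "norm (g (\<i> * of_real t) * h t * \<i>) \<le> norm (of_real M * g (\<i> * of_real t))"
      by (simp add: norm_mult mult.commute[of "norm (g _)"] mult_right_mono)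
  qed
qed

text \<open>The induction carries exactly what the next integration needs: an integrable function times a
  bounded measurable one is integrable, so the outer integral exists and is bounded by an $L^1$
  norm. Measurability in the lower limit is part of Fubini's theorem.\<close>

lemma iter_int_bounded_measurable:
  assumes "\<forall>g\<in>set gs. axis_integrable g"
  shows "(\<exists>M. \<forall>y\<ge>0. norm (iter_int gs y) \<le> M) \<and> set_borel_measurable borel {0<..} (iter_int gs)"
  using assms
proof (induction gs)
  case Nil
  then show ?case by (auto simp: set_borel_measurable_def)
next
  case (Cons g gs)
  then obtain M where M: "\<And>y. y \<ge> 0 \<Longrightarrow> norm (iter_int gs y) \<le> M"
    and meas: "set_borel_measurable borel {0<..} (iter_int gs)" by auto
  define k where "k t = g (\<i> * of_real t) * iter_int gs t * \<i>" for t :: real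
  have k: "set_integrable lborel {0<..} k"
    unfolding k_def using Cons.prems M
    by (intro axis_integrable_mult_bounded[where M = M] meas) auto
  (* Cutting off at 0 makes the integrand globally measurable, whatever the forms are for t \<le> 0. *)
  define k' where "k' = (\<lambda>t::real. indicator {0<..} t *\<^sub>R k t)"
  have k'_int: "integrable lborel k'" using k by (simp add: set_integrable_def k'_def)
  then have [measurable]: "k' \<in> borel_measurable borel" by (auto dest: borel_measurable_integrable)
  have eq: "iter_int (g # gs) y = - (LINT t|lborel. indicator {y<..} t *\<^sub>R k' t)" if "0 \<le> y" for y
    unfolding iter_int_Cons k'_def k_def set_lebesgue_integral_def using that
    by (auto intro!: Bochner_Integration.integral_cong simp: indicator_def)
  have "norm (iter_int (g # gs) y) \<le> (LINT t|lborel. norm (k' t))" if "0 \<le> y" for y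
  proof -
    have "norm (LINT t|lborel. indicator {y<..} t *\<^sub>R k' t) \<le> (LINT t|lborel. norm (indicator {y<..} t *\<^sub>R k' t))"
      by (rule integral_norm_bound)
    also have "\<dots> \<le> (LINT t|lborel. norm (k' t))"
      by (intro integral_mono integrable_norm k'_int integrable_mult_indicator)
         (auto simp: indicator_def)
    finally show ?thesis using that by (simp only: eq norm_minus_cancel)
  qed
  moreover have "set_borel_measurable borel {0<..} (iter_int (g # gs))"
  proof -
    have "(\<lambda>y. indicator {0<..} y *\<^sub>R (- (LINT t|lborel. indicator {y<..} t *\<^sub>R k' t))) \<in> borel_measurable borel"
    proof -
      have "(\<lambda>(y, t). indicator {y<..} t *\<^sub>R k' t) \<in> borel_measurable (borel \<Otimes>\<^sub>M lborel)"
        unfolding indicator_def greaterThan_iff by measurable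
      then have "(\<lambda>y. LINT t|lborel. indicator {y<..} t *\<^sub>R k' t) \<in> borel_measurable borel"
        by (rule lborel.borel_measurable_lebesgue_integral)
      then show ?thesis by measurable
    qed
    then show ?thesis
      unfolding set_borel_measurable_def
      by (rule measurable_cong[THEN iffD1, rotated]) (auto simp: indicator_def eq simp del: iter_int.simps)
  qed
  ultimately show ?case by blast
qed

lemma axis_integrable_iter_int:
  assumes "axis_integrable g" "\<forall>h\<in>set gs. axis_integrable h" "0 \<le> y"
  shows "set_integrable lborel {y<..} (\<lambda>t. g (\<i> * of_real t) * iter_int gs t * \<i>)"
proof -
  obtain M where "\<And>y. y \<ge> 0 \<Longrightarrow> norm (iter_int gs y) \<le> M"
    and "set_borel_measurable borel {0<..} (iter_int gs)"
    using iter_int_bounded_measurable[OF assms(2)] by auto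
  then have "set_integrable lborel {0<..} (\<lambda>t. g (\<i> * of_real t) * iter_int gs t * \<i>)"
    using assms(1) by (intro axis_integrable_mult_bounded[where M = M]) auto
  then show ?thesis by (rule set_integrable_subset) (use assms(3) in auto)
qed

lemma set_lebesgue_integral_sum:
  fixes F :: "'i \<Rightarrow> 'a \<Rightarrow> complex"
  assumes "\<And>i. i \<in> I \<Longrightarrow> set_integrable M A (F i)"
  shows "(LINT t:A|M. \<Sum>i\<in>I. F i t) = (\<Sum>i\<in>I. LINT t:A|M. F i t)"
  using assms unfolding set_lebesgue_integral_def set_integrable_def scaleR_sum_right
  by (rule Bochner_Integration.integral_sum)

text \<open>A word above \<open>v # w\<close> is a letter above \<open>v\<close> followed by a word above \<open>w\<close>, so the sum over words
  factors into a product of sums under the outermost integral sign. Interchanging sum and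
  integral is where the separate integrability of all the \<open>\<omega> x\<close> enters.\<close>

lemma iter_int_multilinear:
  assumes "finite S" "\<And>x. x \<in> S \<Longrightarrow> axis_integrable (\<omega> x)" "0 \<le> y"
  shows "(\<Sum>u | u \<in> lists S \<and> map \<phi> u = w. (\<Prod>x\<leftarrow>u. c x) * iter_int (map \<omega> u) y)
    = iter_int (map (\<lambda>v z. \<Sum>x | x \<in> S \<and> \<phi> x = v. c x * \<omega> x z) w) y"
  using \<open>0 \<le> y\<close>
proof (induction w arbitrary: y)
  case Nil
  have "{u. u \<in> lists S \<and> map \<phi> u = []} = {[]}" by auto
  then show ?case by simp
next
  case (Cons v w)
  let ?A = "{x. x \<in> S \<and> \<phi> x = v}" and ?B = "{u. u \<in> lists S \<and> map \<phi> u = w}"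
  let ?c = "\<lambda>u. \<Prod>x\<leftarrow>u. c x"
  let ?\<eta> = "\<lambda>v z. \<Sum>x | x \<in> S \<and> \<phi> x = v. c x * \<omega> x z"
  let ?k = "\<lambda>(x, u) t. c x * ?c u * (\<omega> x (\<i> * of_real t) * iter_int (map \<omega> u) t * \<i>)"
  have "(\<Sum>u | u \<in> lists S \<and> map \<phi> u = v # w. ?c u * iter_int (map \<omega> u) y)
    = (\<Sum>(x, u)\<in>?A \<times> ?B. c x * ?c u * iter_int (\<omega> x # map \<omega> u) y)"
    by (rule sum.reindex_bij_witness[where i = "\<lambda>(x, u). x # u" and j = "\<lambda>u. (hd u, tl u)"])
       (auto simp: map_eq_Cons_conv simp del: iter_int.simps)
  also have "\<dots> = - (\<Sum>q\<in>?A \<times> ?B. LINT t:{y<..}|lborel. ?k q t)"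
    unfolding sum_negf[symmetric] by (rule sum.cong) (auto simp: iter_int_Cons simp del: iter_int.simps)
  also have "\<dots> = - (LINT t:{y<..}|lborel. \<Sum>q\<in>?A \<times> ?B. ?k q t)"
    using assms(2) Cons.prems
    by (subst set_lebesgue_integral_sum)
       (auto intro!: set_integrable_mult_right axis_integrable_iter_int)
  also have "(LINT t:{y<..}|lborel. \<Sum>q\<in>?A \<times> ?B. ?k q t)
    = (LINT t:{y<..}|lborel. ?\<eta> v (\<i> * of_real t) * iter_int (map ?\<eta> w) t * \<i>)"
  proof (intro set_lebesgue_integral_cong allI impI)
    fix t assume "t \<in> {y<..}"
    then have "iter_int (map ?\<eta> w) t = (\<Sum>u\<in>?B. ?c u * iter_int (map \<omega> u) t)"
      using Cons.IH[of t] Cons.prems by simp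
    then have "?\<eta> v (\<i> * of_real t) * iter_int (map ?\<eta> w) t
        = (\<Sum>(x, u)\<in>?A \<times> ?B. (c x * \<omega> x (\<i> * of_real t)) * (?c u * iter_int (map \<omega> u) t))"
      by (simp only: sum_product sum.cartesian_product)
    then show "(\<Sum>q\<in>?A \<times> ?B. ?k q t) = ?\<eta> v (\<i> * of_real t) * iter_int (map ?\<eta> w) t * \<i>"
      by (simp only: sum_distrib_right) (auto intro!: sum.cong simp: mult_ac)
  qed auto
  finally show ?case by (simp only: list.map iter_int_Cons)
qed

section \<open>Cusp forms on vertical lines over rational numbers\<close>

text \<open>Convergence at $z = i/2$ bounds $a_n$ by a geometric sequence. For $\mathrm{Im}\,z \ge 1$ the series is
  therefore dominated by a geometric series whose ratio stays away from 1, and its leading factor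
  is $e^{-2\pi\,\mathrm{Im}\,z/h}$ because the constant term vanishes.\<close>

lemma q_expansion_decay:
  fixes a :: "nat \<Rightarrow> complex" and h :: nat
  assumes "h > 0" "a 0 = 0"
    and sums: "\<And>z. z \<in> upper_half \<Longrightarrow>
      (\<lambda>n. a n * exp (2 * of_real pi * \<i> * of_nat n * z / of_nat h)) sums g z"
  obtains C k where "C \<ge> 0" "k > 0" "\<And>z. Im z \<ge> 1 \<Longrightarrow> norm (g z) \<le> C * exp (- (k * Im z))"
proof -
  define k where "k = 2 * pi / real h"
  have k: "k > 0" using \<open>h > 0\<close> by (simp add: k_def)
  let ?t = "\<lambda>z n. a n * exp (2 * of_real pi * \<i> * of_nat n * z / of_nat h)"
  have norm_t: "norm (?t z n) = norm (a n) * exp (- (k * Im z)) ^ n" for z n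
    by (simp add: norm_mult k_def exp_of_nat_mult[symmetric] field_simps)
  have "summable (?t (\<i> / 2))"
    using sums[of "\<i> / 2"] by (auto simp: upper_half_def sums_iff)
  then have "Bseq (?t (\<i> / 2))"
    by (rule summable_imp_Bseq)
  then obtain M where M: "\<And>n. norm (?t (\<i> / 2) n) \<le> M" "M > 0"
    by (auto simp: Bseq_def)
  define x where "x = exp (- (k / 2))"
  have x: "0 < x" "x < 1" using k by (auto simp: x_def)
  have a_le: "norm (a n) \<le> M / x ^ n" for n
    using M(1)[of n] x unfolding norm_t by (simp add: x_def[symmetric] field_simps)
  have decay: "norm (g z) \<le> M / (x * (1 - x)) * exp (- (k * Im z))" if "Im z \<ge> 1" for z
  proof -
    define q where "q = exp (- (k * Im z))"
    have "k * 1 \<le> k * Im z" using k that by (intro mult_left_mono) auto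
    then have "q \<le> x * x" "0 < q" by (auto simp: q_def x_def exp_add[symmetric])
    define y where "y = q / x"
    have qy: "q = x * y" and y: "0 < y" "y \<le> x"
      using \<open>q \<le> x * x\<close> \<open>0 < q\<close> x by (auto simp: y_def field_simps)
    have t_le: "norm (?t z (Suc n)) \<le> M * y * y ^ n" for n
    proof -
      have "norm (a (Suc n)) * q ^ Suc n \<le> M / x ^ Suc n * q ^ Suc n"
        using \<open>0 < q\<close> by (intro mult_right_mono a_le) auto
      also have "\<dots> = M * y * y ^ n"
        using x by (simp add: qy power_mult_distrib)
      finally show ?thesis unfolding norm_t q_def[symmetric] .
    qed
    have geo: "(\<lambda>n. M * y * y ^ n) sums (M * y * (1 / (1 - y)))"
      using y x by (intro sums_mult geometric_sums) auto
    have "?t z sums g z"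
      using that by (intro sums) (auto simp: upper_half_def)
    then have "(\<lambda>n. ?t z (Suc n)) sums g z"
      using \<open>a 0 = 0\<close> by (subst sums_Suc_iff) simp
    then have "norm (g z) \<le> M * y * (1 / (1 - y))"
      using norm_suminf_le[of "\<lambda>n. ?t z (Suc n)", OF t_le] geo by (simp add: sums_iff)
    also have "\<dots> \<le> M * y * (1 / (1 - x))"
      using M x y by (intro mult_left_mono frac_le) auto
    also have "\<dots> = M / (x * (1 - x)) * q"
      using x by (simp add: qy field_simps)
    finally show ?thesis using x by (simp add: q_def)
  qed
  show thesis
    by (rule that[of "M / (x * (1 - x))" k]) (use M x k decay in auto)
qed

text \<open>The cusp is $a/c$, the image of $i\infty$; the factor $|cz+d|^2$ comes from weight two.\<close>

lemma cusp_form_decay_at_cusp: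
  fixes a b c d :: int
  assumes "cusp_form 2 \<Gamma> f" and det: "a * d - b * c = 1"
  obtains C k where "C \<ge> 0" "k > 0"
    "\<And>z. Im z \<ge> 1 \<Longrightarrow> norm (f (moebius (of_int a) (of_int b) (of_int c) (of_int d) z))
      \<le> C * norm (of_int c * z + of_int d) ^ 2 * exp (- (k * Im z))"
proof -
  define \<alpha> :: "int^2^2" where "\<alpha> = vector [vector [a, b], vector [c, d]]"
  have "\<alpha> \<in> carrier SL2Z" using det by (simp add: SL2Z_def \<alpha>_def det_2 algebra_simps)
  then obtain h :: nat and e :: "nat \<Rightarrow> complex" where "h > 0" "e 0 = 0"
    "\<And>z. z \<in> upper_half \<Longrightarrow>
      (\<lambda>n. e n * exp (2 * of_real pi * \<i> * of_nat n * z / of_nat h)) sums slash 2 \<alpha> f z"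
    using assms(1) unfolding cusp_form_def by blast
  from q_expansion_decay[OF this] obtain C k where Ck: "C \<ge> 0" "k > 0"
    "\<And>z. Im z \<ge> 1 \<Longrightarrow> norm (slash 2 \<alpha> f z) \<le> C * exp (- (k * Im z))"
    by blast
  show thesis
  proof (rule that[OF Ck(1,2)])
    fix z assume z: "Im z \<ge> 1"
    let ?j = "of_int c * z + of_int d" and ?f = "f (moebius (of_int a) (of_int b) (of_int c) (of_int d) z)"
    have "?j \<noteq> 0"
    proof
      assume "?j = 0"
      then have "Im ?j = 0" "Re ?j = 0" by simp_all
      then have "c = 0" "d = 0" using z by auto
      then show False using det by simp
    qed
    have "slash 2 \<alpha> f z = ?f / ?j ^ 2"
      by (simp add: slash_def \<alpha>_def power_int_def field_simps)
    then have "norm ?f = norm (slash 2 \<alpha> f z) * norm ?j ^ 2"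
      using \<open>?j \<noteq> 0\<close> by (simp add: norm_divide norm_power)
    also have "\<dots> \<le> C * exp (- (k * Im z)) * norm ?j ^ 2"
      using Ck(3)[OF z] by (intro mult_right_mono) auto
    finally show "norm ?f \<le> C * norm ?j ^ 2 * exp (- (k * Im z))" by (simp add: mult_ac)
  qed
qed

text \<open>Complete $(a,c)$ to a matrix in $SL_2(\mathbb{Z})$ with lower row $(c,u)$. The point $a/c + is$ is the
  image of $z = -u/c + iy$ with $y = 1/(c^2 s)$, so the cusp $a/c$ is approached as $y \to \infty$.
  There $|cz+u|^2 = c^2y^2$, and $y^2e^{-ky}$ is bounded.\<close>

lemma cusp_form_bounded_near_rational:
  fixes a c :: int
  assumes "cusp_form 2 \<Gamma> f" "c > 0" "coprime a c"
  obtains B \<epsilon> where "\<epsilon> > 0"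
    "\<And>s. 0 < s \<Longrightarrow> s \<le> \<epsilon> \<Longrightarrow> norm (f (of_int a / of_int c + \<i> * of_real s)) \<le> B"
proof -
  obtain u v where "u * a + v * c = 1"
    using bezout_int[of a c] \<open>coprime a c\<close> by auto
  then have det: "a * u - (- v) * c = 1" by (simp add: algebra_simps)
  obtain C k where Ck: "C \<ge> 0" "k > 0"
    "\<And>z. Im z \<ge> 1 \<Longrightarrow> norm (f (moebius (of_int a) (of_int (- v)) (of_int c) (of_int u) z))
      \<le> C * norm (of_int c * z + of_int u) ^ 2 * exp (- (k * Im z))"
    using cusp_form_decay_at_cusp[OF assms(1) det] by blast
  show thesis
  proof (rule that)
    show "1 / (of_int c)^2 > (0::real)" using \<open>c > 0\<close> by simp
    fix s :: real assume s: "0 < s" "s \<le> 1 / (of_int c)^2"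
    define y where "y = 1 / ((of_int c)^2 * s)"
    define z where "z = Complex (- of_int u / of_int c) y"
    have y: "y \<ge> 1" using s \<open>c > 0\<close> by (simp add: y_def field_simps)
    have j: "of_int c * z + of_int u = \<i> * of_real (of_int c * y)"
      using \<open>c > 0\<close> by (simp add: z_def complex_eq_iff)
    have "of_int (u * a + v * c) = (1 :: complex)"
      unfolding \<open>u * a + v * c = 1\<close> by simp
    then have "(of_int a * z - of_int v) * of_int c = of_int a * (of_int c * z + of_int u) - 1"
      by (simp add: algebra_simps)
    then have num: "of_int a * z - of_int v = (of_int a * (\<i> * of_real (of_int c * y)) - 1) / of_int c"
      using \<open>c > 0\<close> unfolding j by (simp add: nonzero_eq_divide_eq)
    have sy: "of_real s * (of_int c * of_real (of_int c * y)) = (1 :: complex)"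
      using s \<open>c > 0\<close> by (simp add: y_def power2_eq_square)
    have "moebius (of_int a) (of_int (- v)) (of_int c) (of_int u) z = of_int a / of_int c + \<i> * of_real s"
      using \<open>c > 0\<close> y sy
      by (simp add: moebius_def num j divide_simps) (simp add: algebra_simps)?
    then have "norm (f (of_int a / of_int c + \<i> * of_real s)) \<le> C * (of_int c * y)^2 * exp (- (k * y))"
      using Ck(3)[of z] y \<open>c > 0\<close> by (simp add: z_def[THEN arg_cong[where f = Im]] j norm_mult)
    also have "\<dots> \<le> C * (2 * (of_int c)^2 / k^2)"
    proof -
      have "(k * y)^2 / 2 \<le> exp (k * y)"
        using exp_lower_Taylor_quadratic[of "k * y"] mult_nonneg_nonneg[of k y] Ck(2) y by linarith
      then have "y^2 * exp (- (k * y)) \<le> 2 / k^2"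
        using Ck(2) by (simp add: exp_minus field_simps)
      then have "C * ((of_int c)^2 * (y^2 * exp (- (k * y)))) \<le> C * ((of_int c)^2 * (2 / k^2))"
        using Ck(1) by (intro mult_left_mono) auto
      then show ?thesis by (simp add: power_mult_distrib mult_ac)
    qed
    finally show "norm (f (of_int a / of_int c + \<i> * of_real s)) \<le> C * (2 * (of_int c)^2 / k^2)" .
  qed
qed

text \<open>The line splits into the part near the rational number, a compact segment, and the part near
  $i\infty$. The function is bounded on the first two parts and decays exponentially on the third, so a
  single multiple of $e^{-ks}$ dominates it everywhere.\<close>

lemma cusp_form_integrable_over_rational:
  assumes f: "cusp_form 2 \<Gamma> f" and "r \<in> \<rat>"
  shows "set_integrable lborel {0<..} (\<lambda>s. f (of_real r + \<i> * of_real s))"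
proof -
  let ?F = "\<lambda>s. f (of_real r + \<i> * of_real s)"
  have cont: "continuous_on {0<..} ?F"
    using f unfolding cusp_form_def
    by (intro continuous_on_compose2[OF holomorphic_on_imp_continuous_on[of f upper_half]] continuous_intros)
       (auto simp: upper_half_def)
  obtain a c where "c > 0" "coprime a c" and r: "r = of_int a / of_int c"
    using \<open>r \<in> \<rat>\<close> by (auto elim: Rats_cases')
  obtain B \<epsilon> where "\<epsilon> > 0"
    and "\<And>s. 0 < s \<Longrightarrow> s \<le> \<epsilon> \<Longrightarrow> norm (f (of_int a / of_int c + \<i> * of_real s)) \<le> B"
    using cusp_form_bounded_near_rational[OF f \<open>c > 0\<close> \<open>coprime a c\<close>] by blast
  then have near: "\<And>s. 0 < s \<Longrightarrow> s \<le> \<epsilon> \<Longrightarrow> norm (?F s) \<le> B" by (simp add: r)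
  obtain C k where Ck: "C \<ge> 0" "k > 0"
    and far: "\<And>z. Im z \<ge> 1 \<Longrightarrow> norm (f z) \<le> C * exp (- (k * Im z))"
    using cusp_form_decay_at_cusp[OF f, of 1 1 0 0] by (auto simp: moebius_def)
  have "bounded (?F ` {\<epsilon>..1})"
    using \<open>\<epsilon> > 0\<close> by (intro compact_imp_bounded compact_continuous_image continuous_on_subset[OF cont]) auto
  then obtain D where mid: "\<forall>s\<in>{\<epsilon>..1}. norm (?F s) \<le> D"
    by (auto simp: bounded_iff)
  (* The factor exp k compensates exp (- (s * k)) on s < 1. *)
  define E where "E = max 0 (max B D) * exp k + C"
  have bound: "norm (?F s) \<le> E * exp (- (s * k))" if "s > 0" for s
  proof (cases "s \<ge> 1")
    case True
    then have "norm (?F s) \<le> C * exp (- (s * k))"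
      using far[of "of_real r + \<i> * of_real s"] by (simp add: mult.commute)
    also have "\<dots> \<le> E * exp (- (s * k))"
      by (intro mult_right_mono) (auto simp: E_def)
    finally show ?thesis .
  next
    case False
    have "norm (?F s) \<le> max 0 (max B D)"
      using near[of s] bspec[OF mid, of s] that False by (cases "s \<le> \<epsilon>") auto
    also have "\<dots> \<le> max 0 (max B D) * exp (k - s * k)"
      using False Ck(2) by (simp add: mult_le_cancel_left1)
    also have "\<dots> = max 0 (max B D) * exp k * exp (- (s * k))"
      by (simp add: exp_diff exp_minus field_simps)
    also have "\<dots> \<le> E * exp (- (s * k))"
      using Ck(1) by (intro mult_right_mono) (auto simp: E_def)
    finally show ?thesis .
  qed
  show ?thesis
  proof (rule set_integrable_bound)
    show "set_integrable lborel {0<..} (\<lambda>s. E * exp (- (s * k)))"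
      using integrable_I0i_exp_mscale[OF Ck(2)] by simp
    show "set_borel_measurable lborel {0<..} ?F"
      using borel_measurable_continuous_on_indicator[OF _ cont] by (simp add: set_borel_measurable_def)
    show "AE s in lborel. s \<in> {0<..} \<longrightarrow> norm (?F s) \<le> norm (E * exp (- (s * k)))"
      using bound by (intro AE_I2) (auto intro: order_trans[OF _ abs_ge_self])
  qed
qed

lemma set_integrable_scale:
  fixes F :: "real \<Rightarrow> complex"
  assumes "set_integrable lborel {0<..} F" "c > 0"
  shows "set_integrable lborel {0<..} (\<lambda>t. F (c * t))"
  using lborel_integrable_real_affine[of "\<lambda>t. indicator {0<..} t *\<^sub>R F t" c 0] assms
  by (simp add: set_integrable_def indicator_def zero_less_mult_iff)

lemma pullback_p_mat: "pullback (p_mat p) f z = f (of_nat p * z) * of_nat p"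
proof -
  have "deriv (\<lambda>z::complex. of_nat p * z) z = of_nat p"
    by (intro DERIV_imp_deriv) (auto intro!: derivative_eq_intros)
  then show ?thesis by (simp add: pullback_def p_mat_def moebius_def)
qed

lemma pullback_h_mat:
  "pullback (h_mat p b) f z = f ((z + of_nat b) / of_nat p) / of_nat p"
proof -
  have "deriv (\<lambda>z::complex. (z + of_nat b) / of_nat p) z = 1 / of_nat p"
    by (intro DERIV_imp_deriv) (auto intro!: derivative_eq_intros simp: divide_inverse)
  then show ?thesis by (simp add: pullback_def h_mat_def moebius_def)
qed

lemma axis_integrable_cusp_form:
  assumes "cusp_form 2 \<Gamma> f"
  shows "axis_integrable f"
  using cusp_form_integrable_over_rational[OF assms, of 0] by (simp add: axis_integrable_def)

lemma axis_integrable_pullback_p_mat: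
  assumes "cusp_form 2 \<Gamma> f" "p > 0"
  shows "axis_integrable (pullback (p_mat p) f)"
  using set_integrable_scale[OF cusp_form_integrable_over_rational[OF assms(1), of 0], of "of_nat p"] assms(2)
  by (simp add: axis_integrable_def pullback_p_mat mult.left_commute)

lemma axis_integrable_pullback_h_mat:
  assumes "cusp_form 2 \<Gamma> f" "p > 0"
  shows "axis_integrable (pullback (h_mat p b) f)"
  using set_integrable_scale[OF cusp_form_integrable_over_rational[OF assms(1), of "of_nat b / of_nat p"],
      of "1 / of_nat p"] assms(2)
  by (simp add: axis_integrable_def pullback_h_mat add_divide_distrib add.commute)

section \<open>The Hecke relation for generating series\<close>

text \<open>By uniqueness \<open>\<Phi>\<close> is the substitution $X_x \mapsto c_x Y_{\varphi(x)}$, whose effect on the coefficients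
  is the sum over words that multilinearity evaluates.\<close>

lemma continuous_alg_hom_J_series:
  assumes "finite S" "\<phi> \<in> S \<rightarrow> T" and \<Phi>: "continuous_alg_hom S T \<Phi>"
    and var: "\<And>x. x \<in> S \<Longrightarrow> \<Phi> (ncps_var x) = ncps_scale (c x) (ncps_var (\<phi> x))"
    and int: "\<And>x. x \<in> S \<Longrightarrow> axis_integrable (\<omega> x)"
  shows "\<Phi> (J_series S \<omega>) = (\<lambda>w. iter_int (map (\<lambda>v z. \<Sum>x | x \<in> S \<and> \<phi> x = v. c x * \<omega> x z) w) 0)"
proof -
  have "J_series S \<omega> \<in> carrier (ncps S)" by (simp add: J_series_def ncps_def)
  then have "\<Phi> (J_series S \<omega>) = ncps_subst S \<phi> c (J_series S \<omega>)"
    by (rule continuous_alg_hom_unique[OF assms(1) \<Phi> continuous_alg_hom_ncps_subst[OF assms(1,2)], rotated])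
       (simp add: var ncps_subst_var[OF assms(1)])
  also have "\<dots> = (\<lambda>w. \<Sum>u | u \<in> lists S \<and> map \<phi> u = w. (\<Prod>x\<leftarrow>u. c x) * iter_int (map \<omega> u) 0)"
    unfolding ncps_subst_def J_series_def by (intro ext sum.cong) auto
  also have "\<dots> = (\<lambda>w. iter_int (map (\<lambda>v z. \<Sum>x | x \<in> S \<and> \<phi> x = v. c x * \<omega> x z) w) 0)"
    using assms(1) int by (intro ext iter_int_multilinear) auto
  finally show ?thesis .
qed

theorem theorem5p3:
  fixes V :: "'v set"
    and f :: "'v \<Rightarrow> complex \<Rightarrow> complex"
    and \<Gamma> :: "'v \<Rightarrow> (int^2^2) set"
    and p :: "'v \<Rightarrow> nat"
    and lam :: "'v \<Rightarrow> complex"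
    and l :: "('v + 'v) ncps \<Rightarrow> 'v ncps"
    and r :: "('v \<times> nat) ncps \<Rightarrow> 'v ncps"
  assumes "finite V"
    and "\<And>v. v \<in> V \<Longrightarrow> congruence_subgroup (\<Gamma> v)"
    and "\<And>v. v \<in> V \<Longrightarrow> cusp_form 2 (\<Gamma> v) (f v)"
    and "\<And>v. v \<in> V \<Longrightarrow> prime (p v)"
    and "\<And>v z. v \<in> V \<Longrightarrow> z \<in> upper_half \<Longrightarrow> hecke (p v) (f v) z = lam v * f v z"
    and "continuous_alg_hom (V <+> V) V l"
    and "\<And>v. v \<in> V \<Longrightarrow> l (ncps_var (Inl v)) = ncps_scale (lam v) (ncps_var v)"
    and "\<And>v. v \<in> V \<Longrightarrow> l (ncps_var (Inr v)) = ncps_scale (-1) (ncps_var v)"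
    and "continuous_alg_hom (index_W V p) V r"
    and "\<And>v b. (v, b) \<in> index_W V p \<Longrightarrow> r (ncps_var (v, b)) = ncps_var v"
  shows "l (J_series (V <+> V) (omega_U p f)) = r (J_series (index_W V p) (omega_W p f))"
proof -
  let ?fold = "case_sum id id :: 'v + 'v \<Rightarrow> 'v"
  let ?c = "case_sum lam (\<lambda>_. - 1) :: 'v + 'v \<Rightarrow> complex"
  let ?\<eta>U = "\<lambda>v z. \<Sum>x | x \<in> V <+> V \<and> ?fold x = v. ?c x * omega_U p f x z"
  let ?\<eta>W = "\<lambda>v z. \<Sum>x | x \<in> index_W V p \<and> fst x = v. 1 * omega_W p f x z"
  have p: "p v > 0" if "v \<in> V" for v
    using assms(4)[OF that] by (rule prime_gt_0_nat)
  have "l (J_series (V <+> V) (omega_U p f)) = (\<lambda>w. iter_int (map ?\<eta>U w) 0)"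
  proof (rule continuous_alg_hom_J_series[OF _ _ assms(6)])
    show "axis_integrable (omega_U p f x)" if "x \<in> V <+> V" for x
      using that
      by (auto simp: omega_U_def intro!: axis_integrable_cusp_form[OF assms(3)]
          axis_integrable_pullback_p_mat[OF assms(3) p])
  qed (use assms(1,7,8) in auto)
  moreover have "r (J_series (index_W V p) (omega_W p f)) = (\<lambda>w. iter_int (map ?\<eta>W w) 0)"
  proof (rule continuous_alg_hom_J_series[OF _ _ assms(9)])
    show "axis_integrable (omega_W p f x)" if "x \<in> index_W V p" for x
      using that
      by (auto simp: omega_W_def index_W_def intro!: axis_integrable_pullback_h_mat[OF assms(3) p])
    show "finite (index_W V p)" using assms(1) by (simp add: index_W_def)
    show "r (ncps_var x) = ncps_scale 1 (ncps_var (fst x))" if "x \<in> index_W V p" for x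
      using that assms(10)[of "fst x" "snd x"] by (simp add: ncps_scale_def)
  qed (auto simp: index_W_def)
  moreover have "iter_int (map ?\<eta>U w) 0 = iter_int (map ?\<eta>W w) 0" for w
  proof (rule iter_int_cong)
    (* For v in V this is the Hecke equation on the axis; for other letters both sums are empty. *)
    have "?\<eta>U v (\<i> * of_real t) = ?\<eta>W v (\<i> * of_real t)" if "t > 0" for v and t :: real
    proof (cases "v \<in> V")
      case True
      let ?z = "\<i> * of_real t"
      have U: "{x. x \<in> V <+> V \<and> ?fold x = v} = {Inl v, Inr v}" using True by auto
      have W: "{x. x \<in> index_W V p \<and> fst x = v} = Pair v ` {..<p v}"
        using True by (auto simp: index_W_def)
      have "?\<eta>U v ?z = lam v * f v ?z - pullback (p_mat (p v)) (f v) ?z"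
        unfolding U by (simp add: omega_U_def)
      also have "\<dots> = (\<Sum>b<p v. pullback (h_mat (p v) b) (f v) ?z)"
        using assms(5)[OF True, of ?z] \<open>t > 0\<close> by (simp add: upper_half_def hecke_def algebra_simps)
      also have "\<dots> = ?\<eta>W v ?z"
        unfolding W by (simp add: sum.reindex inj_on_def omega_W_def)
      finally show ?thesis .
    next
      case False
      then have "{x. x \<in> V <+> V \<and> ?fold x = v} = {}" "{x. x \<in> index_W V p \<and> fst x = v} = {}"
        by (auto simp: index_W_def)
      then show ?thesis by (simp only: sum.empty)
    qed
    then show "list_all2 (\<lambda>g h. \<forall>t>0. g (\<i> * of_real t) = h (\<i> * of_real t)) (map ?\<eta>U w) (map ?\<eta>W w)"
      by (simp add: list_all2_conv_all_nth)
  qed simp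
  ultimately show ?thesis by simp
qed

end
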